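(* Let $k$ be a fixed positive integer and $R$ a ring. There is an $O(n^2)$-time deterministic reduction from $k$-$\mathrm{MMV}_R$ on $n\times n$ matrices to $k$-$\mathrm{AllZeroes}_R$ on $2n\times 2n$ matrices.
   Context: $k$-$\mathrm{MMV}_R$: given $A_1,\ldots,A_k,C\in R^{n\times n}$, decide whether $\prod_{i=1}^k A_i = C$. $k$-$\mathrm{AllZeroes}_R$: given $A_1,\ldots,A_k\in R^{n\times n}$, decide whether $\prod_{i=1}^k A_i = 0$. A reduction maps each instance of the first problem to an instance of the second with the same yes/no answer; arithmetic operations over $R$ are counted as constant time. *)

theory Defs
  imports "Jordan_Normal_Form.Matrix" "HOL-Library.Landau_Symbols"
begin

text \<open>
  A ring is a type of sort \<open>{ring, monoid_mult}\<close>: associative and unital, not necessarily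
  commutative. The class \<open>ring_1\<close> would additionally exclude the zero ring.
\<close>

section \<open>Problems on lists of square matrices\<close>

text \<open>Both components are indexed by the dimension of the matrices.\<close>

record 'a problem =
  instances :: "nat \<Rightarrow> 'a mat list set"
  yes_instances :: "nat \<Rightarrow> 'a mat list set"

definition mat_prod_list :: "nat \<Rightarrow> 'a::{ring,monoid_mult} mat list \<Rightarrow> 'a mat" where
  "mat_prod_list n As = foldr (*) As (1\<^sub>m n)"

definition MMV :: "nat \<Rightarrow> 'a::{ring,monoid_mult} problem" where
  "MMV k = \<lparr>
     instances = (\<lambda>n. {As @ [C] | As C.
       length As = k \<and> set As \<subseteq> carrier_mat n n \<and> C \<in> carrier_mat n n}),
     yes_instances = (\<lambda>n. {As @ [C] | As C.
       length As = k \<and> set As \<subseteq> carrier_mat n n \<and> C \<in> carrier_mat n n \<and>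
       mat_prod_list n As = C}) \<rparr>"

definition AllZeroes :: "nat \<Rightarrow> 'a::{ring,monoid_mult} problem" where
  "AllZeroes k = \<lparr>
     instances = (\<lambda>n. {As. length As = k \<and> set As \<subseteq> carrier_mat n n}),
     yes_instances = (\<lambda>n. {As. length As = k \<and> set As \<subseteq> carrier_mat n n \<and>
       mat_prod_list n As = 0\<^sub>m n n}) \<rparr>"


section \<open>Random access machine over a ring\<close>

text \<open>
  A machine state has natural-number registers (for counters and addresses) and a memory of
  ring elements. Programs are uniform: the same program runs for every dimension, and, since
  0 and 1 are the only ring constants, its text does not mention the ring. Every elementary
  instruction and every evaluation of a branching condition costs one time unit. Registers
  have addition and truncated subtraction but no unit-cost multiplication, which on unbounded
  numbers would be unreasonably powerful.
\<close>

record 'a state =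
  reg :: "nat \<Rightarrow> nat"
  mem :: "nat \<Rightarrow> 'a"

text \<open>
  The arguments of the instructions are register numbers, except the second argument of
  \<open>IConst\<close>, which is a literal. All accesses to the ring memory are indirect.
\<close>

datatype instr =
    IConst nat nat
  | ICopy nat nat
  | IAdd nat nat nat
  | ISub nat nat nat
  | ILoad nat nat
  | IStore nat nat
  | RZero nat
  | ROne nat
  | RCopy nat nat
  | RAdd nat nat nat
  | RSub nat nat nat
  | RMult nat nat nat

fun exec :: "instr \<Rightarrow> 'a::{ring,monoid_mult} state \<Rightarrow> 'a state" where
  "exec (IConst x c) s = s\<lparr>reg := (reg s)(x := c)\<rparr>"
| "exec (ICopy x y) s = s\<lparr>reg := (reg s)(x := reg s y)\<rparr>"
| "exec (IAdd x y z) s = s\<lparr>reg := (reg s)(x := reg s y + reg s z)\<rparr>"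
| "exec (ISub x y z) s = s\<lparr>reg := (reg s)(x := reg s y - reg s z)\<rparr>"
| "exec (ILoad x y) s = s\<lparr>reg := (reg s)(x := reg s (reg s y))\<rparr>"
| "exec (IStore x y) s = s\<lparr>reg := (reg s)(reg s x := reg s y)\<rparr>"
| "exec (RZero x) s = s\<lparr>mem := (mem s)(reg s x := 0)\<rparr>"
| "exec (ROne x) s = s\<lparr>mem := (mem s)(reg s x := 1)\<rparr>"
| "exec (RCopy x y) s = s\<lparr>mem := (mem s)(reg s x := mem s (reg s y))\<rparr>"
| "exec (RAdd x y z) s = s\<lparr>mem := (mem s)(reg s x := mem s (reg s y) + mem s (reg s z))\<rparr>"
| "exec (RSub x y z) s = s\<lparr>mem := (mem s)(reg s x := mem s (reg s y) - mem s (reg s z))\<rparr>"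
| "exec (RMult x y z) s = s\<lparr>mem := (mem s)(reg s x := mem s (reg s y) * mem s (reg s z))\<rparr>"

datatype cond =
    CLess nat nat
  | CEq nat nat
  | CZero nat

fun holds :: "cond \<Rightarrow> 'a::{ring,monoid_mult} state \<Rightarrow> bool" where
  "holds (CLess x y) s = (reg s x < reg s y)"
| "holds (CEq x y) s = (reg s x = reg s y)"
| "holds (CZero x) s = (mem s (reg s x) = 0)"

datatype prog =
    Skip
  | Do instr
  | Seq prog prog
  | Cond cond prog prog
  | While cond prog

text \<open>\<open>run p s t s'\<close>: started in \<open>s\<close>, program \<open>p\<close> halts in \<open>s'\<close> after exactly \<open>t\<close> time units.\<close>

inductive run :: "prog \<Rightarrow> 'a::{ring,monoid_mult} state \<Rightarrow> nat \<Rightarrow> 'a state \<Rightarrow> bool" where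
  run_Skip: "run Skip s 0 s"
| run_Do: "run (Do i) s 1 (exec i s)"
| run_Seq: "run p s t s' \<Longrightarrow> run q s' u s'' \<Longrightarrow> run (Seq p q) s (t + u) s''"
| run_Cond_True: "holds b s \<Longrightarrow> run p s t s' \<Longrightarrow> run (Cond b p q) s (1 + t) s'"
| run_Cond_False: "\<not> holds b s \<Longrightarrow> run q s t s' \<Longrightarrow> run (Cond b p q) s (1 + t) s'"
| run_While_False: "\<not> holds b s \<Longrightarrow> run (While b p) s 1 s"
| run_While_True: "holds b s \<Longrightarrow> run p s t s' \<Longrightarrow> run (While b p) s' u s'' \<Longrightarrow>
    run (While b p) s (1 + t + u) s''"

inductive_cases run_SkipE: "run Skip s t s'"
inductive_cases run_DoE: "run (Do i) s t s'"
inductive_cases run_SeqE: "run (Seq p q) s t s'"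
inductive_cases run_CondE: "run (Cond b p q) s t s'"
inductive_cases run_WhileE: "run (While b p) s t s'"

lemma run_deterministic:
  "run p s t s' \<Longrightarrow> run p s u s'' \<Longrightarrow> t = u \<and> s' = s''"
proof (induction arbitrary: u s'' rule: run.induct)
  case (run_Skip s)
  then show ?case by (auto elim: run_SkipE)
next
  case (run_Do i s)
  then show ?case by (auto elim: run_DoE)
next
  case (run_Seq p s t s' q v r)
  from run_Seq.prems obtain t1 t2 s1
    where "run p s t1 s1" "run q s1 t2 s''" "u = t1 + t2" by (auto elim: run_SeqE)
  with run_Seq.IH show ?case by blast
next
  case (run_Cond_True b s p t s' q)
  from run_Cond_True.prems run_Cond_True.hyps obtain v
    where "run p s v s''" "u = 1 + v" by (auto elim: run_CondE)
  with run_Cond_True.IH show ?case by blast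
next
  case (run_Cond_False b s q t s' p)
  from run_Cond_False.prems run_Cond_False.hyps obtain v
    where "run q s v s''" "u = 1 + v" by (auto elim: run_CondE)
  with run_Cond_False.IH show ?case by blast
next
  case (run_While_False b s p)
  from run_While_False.prems run_While_False.hyps show ?case
    by (auto elim: run_WhileE)
next
  case (run_While_True b s p t s' v r)
  from run_While_True.prems run_While_True.hyps obtain t1 t2 s1
    where "run p s t1 s1" "run (While b p) s1 t2 s''" "u = 1 + t1 + t2"
    by (auto elim: run_WhileE)
  with run_While_True.IH show ?case by blast
qed

text \<open>
  A list of \<open>n \<times> n\<close> matrices is stored row by row, one matrix after the other. Register 0
  holds the dimension and register 1 the address of the first entry. The initial state stores
  the list from address 0 on; all other registers and cells are 0.
\<close>

definition represents :: "'a state \<Rightarrow> nat \<Rightarrow> 'a mat list \<Rightarrow> bool" where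
  "represents s n Ms \<longleftrightarrow> reg s 0 = n \<and>
     (\<forall>l < length Ms. \<forall>i < n. \<forall>j < n.
        mem s (reg s 1 + l * (n * n) + i * n + j) = (Ms ! l) $$ (i, j))"

definition initial_state :: "nat \<Rightarrow> 'a::zero mat list \<Rightarrow> 'a state" where
  "initial_state n Ms = \<lparr>
     reg = (\<lambda>_. 0)(0 := n),
     mem = (\<lambda>a. if a < length Ms * (n * n)
                then (Ms ! (a div (n * n))) $$ (a mod (n * n) div n, a mod n) else 0) \<rparr>"

lemma represents_initial_state: "represents (initial_state n Ms) n Ms"
proof -
  have "mem (initial_state n Ms) (l * (n * n) + i * n + j) = (Ms ! l) $$ (i, j)"
    if l: "l < length Ms" and i: "i < n" and j: "j < n" for l i j
  proof -
    have "i * n + j < Suc i * n" using j by simp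
    also have "\<dots> \<le> n * n" using i by (intro mult_le_mono1) simp
    finally have b: "i * n + j < n * n" .
    have "l * (n * n) + (i * n + j) < Suc l * (n * n)" using b by simp
    also have "\<dots> \<le> length Ms * (n * n)" using l by (intro mult_le_mono1) simp
    finally have c: "l * (n * n) + (i * n + j) < length Ms * (n * n)" .
    have d: "(l * (n * n) + (i * n + j)) div (n * n) = l"
      using b by (metis add.right_neutral div_less div_mult_self3 less_nat_zero_code)
    have e: "(l * (n * n) + (i * n + j)) mod (n * n) = i * n + j" using b by simp
    have f: "(i * n + j) div n = i" "(i * n + j) mod n = j" using j by simp_all
    have g: "(l * (n * n) + (i * n + j)) mod n = j"
      using e f(2) by (metis mod_mod_cancel dvd_triv_left)
    show ?thesis using c d e f g by (simp add: initial_state_def add.assoc)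
  qed
  then show ?thesis by (simp add: represents_def) (simp add: initial_state_def)
qed


section \<open>Reductions with a time bound\<close>

text \<open>
  Program \<open>p\<close> maps every instance of \<open>X\<close> of dimension \<open>n\<close> to an instance of \<open>Y\<close> of
  dimension \<open>d n\<close> with the same answer, within \<open>T n\<close> time units.
\<close>

definition is_reduction ::
  "prog \<Rightarrow> 'a::{ring,monoid_mult} problem \<Rightarrow> 'a problem \<Rightarrow> (nat \<Rightarrow> nat) \<Rightarrow> (nat \<Rightarrow> nat) \<Rightarrow> bool"
where
  "is_reduction p X Y d T \<longleftrightarrow>
     (\<forall>n. \<forall>x \<in> instances X n. \<exists>t s. \<exists>y \<in> instances Y (d n).
        run p (initial_state n x) t s \<and> t \<le> T n \<and> represents s (d n) y \<and>
        (x \<in> yes_instances X n \<longleftrightarrow> y \<in> yes_instances Y (d n)))"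

end

theory Submission
  imports Defs
begin

text \<open>
  For \<open>k \<ge> 2\<close> the matrices \<open>A\<^sub>1, \<dots>, A\<^sub>k, C\<close> are mapped to the block matrices
  \<open>[[A\<^sub>1, -C], [0, 0]]\<close>, \<open>[[A\<^sub>i, 0], [0, I]]\<close> for \<open>1 < i < k\<close>, and \<open>[[A\<^sub>k, 0], [I, 0]]\<close>,
  whose product is \<open>[[A\<^sub>1 \<cdots> A\<^sub>k - C, 0], [0, 0]]\<close>; for \<open>k = 1\<close> the single matrix
  \<open>[[A\<^sub>1 - C, 0], [0, 0]]\<close> is produced directly. The output is written behind the input, where
  the memory is still zero, so that only the blocks \<open>A\<^sub>i\<close>, \<open>-C\<close> and \<open>I\<close> have to be filled in.
\<close>

section \<open>Block matrices\<close>

text \<open>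
  The library versions of the unit laws require \<open>semiring_1\<close>, which excludes the zero ring.
\<close>

lemma left_mult_one_mat_ring:
  fixes A :: "'a::{ring,monoid_mult} mat"
  assumes "A \<in> carrier_mat nr nc"
  shows "1\<^sub>m nr * A = A"
proof (rule eq_matI)
  fix i j assume ij: "i < dim_row A" "j < dim_col A"
  with assms have "i < nr" "j < nc" by auto
  have "(1\<^sub>m nr * A) $$ (i, j) = (\<Sum>l\<in>{0..<nr}. (if i = l then 1 else 0) * A $$ (l, j))"
    using assms \<open>i < nr\<close> \<open>j < nc\<close> by (auto simp: scalar_prod_def intro!: sum.cong)
  also have "\<dots> = (\<Sum>l\<in>{0..<nr}. if i = l then A $$ (l, j) else 0)"
    by (intro sum.cong) auto
  also have "\<dots> = A $$ (i, j)" using \<open>i < nr\<close> by simp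
  finally show "(1\<^sub>m nr * A) $$ (i, j) = A $$ (i, j)" .
qed (use assms in auto)

lemma right_mult_one_mat_ring:
  fixes A :: "'a::{ring,monoid_mult} mat"
  assumes "A \<in> carrier_mat nr nc"
  shows "A * 1\<^sub>m nc = A"
proof (rule eq_matI)
  fix i j assume ij: "i < dim_row A" "j < dim_col A"
  with assms have "i < nr" "j < nc" by auto
  have "(A * 1\<^sub>m nc) $$ (i, j) = (\<Sum>l\<in>{0..<nc}. A $$ (i, l) * (if l = j then 1 else 0))"
    using assms \<open>i < nr\<close> \<open>j < nc\<close> by (auto simp: scalar_prod_def intro!: sum.cong)
  also have "\<dots> = (\<Sum>l\<in>{0..<nc}. if l = j then A $$ (i, l) else 0)"
    by (intro sum.cong) auto
  also have "\<dots> = A $$ (i, j)" using \<open>j < nc\<close> by simp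
  finally show "(A * 1\<^sub>m nc) $$ (i, j) = A $$ (i, j)" .
qed (use assms in auto)

lemma mat_prod_list_Nil [simp]: "mat_prod_list n [] = 1\<^sub>m n"
  by (simp add: mat_prod_list_def)

lemma mat_prod_list_Cons [simp]: "mat_prod_list n (A # As) = A * mat_prod_list n As"
  by (simp add: mat_prod_list_def)

lemma mat_prod_list_carrier:
  "set As \<subseteq> carrier_mat n n \<Longrightarrow> mat_prod_list n As \<in> carrier_mat n n"
  by (induction As) auto

section \<open>Zero tests for differences and for block matrices with one nonzero block\<close>

lemma minus_mat_eq_zero_iff:
  fixes A B :: "'a::group_add mat"
  assumes "A \<in> carrier_mat nr nc" "B \<in> carrier_mat nr nc"
  shows "A - B = 0\<^sub>m nr nc \<longleftrightarrow> A = B"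
proof
  assume eq: "A - B = 0\<^sub>m nr nc"
  show "A = B"
  proof (rule eq_matI)
    fix i j assume "i < dim_row B" "j < dim_col B"
    then have "(A - B) $$ (i, j) = 0" using eq assms by simp
    then show "A $$ (i, j) = B $$ (i, j)"
      using assms \<open>i < dim_row B\<close> \<open>j < dim_col B\<close> by simp
  qed (use assms in auto)
qed (use assms in simp)

lemma four_block_upper_left_eq_zero_iff:
  assumes "A \<in> carrier_mat n n"
  shows "four_block_mat A (0\<^sub>m n n) (0\<^sub>m n n) (0\<^sub>m n n) = 0\<^sub>m (2 * n) (2 * n) \<longleftrightarrow> A = 0\<^sub>m n n"
    (is "?F = _ \<longleftrightarrow> _")
proof
  assume eq: "?F = 0\<^sub>m (2 * n) (2 * n)"
  show "A = 0\<^sub>m n n"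
  proof (rule eq_matI)
    fix i j assume "i < dim_row (0\<^sub>m n n)" "j < dim_col (0\<^sub>m n n)"
    then have ij: "i < n" "j < n" by auto
    then have "?F $$ (i, j) = A $$ (i, j)" using assms by simp
    then show "A $$ (i, j) = 0\<^sub>m n n $$ (i, j)" using ij eq by simp
  qed (use assms in auto)
qed (simp add: mult_2)

lemma four_block_minus_eq_zero_iff:
  fixes A C :: "'a::group_add mat"
  assumes "A \<in> carrier_mat n n" "C \<in> carrier_mat n n"
  shows "four_block_mat (A - C) (0\<^sub>m n n) (0\<^sub>m n n) (0\<^sub>m n n) = 0\<^sub>m (2 * n) (2 * n) \<longleftrightarrow> A = C"
  using four_block_upper_left_eq_zero_iff[of "A - C" n] minus_mat_eq_zero_iff[OF assms] assms
  by (simp add: minus_carrier_mat)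

section \<open>The three block shapes of the output and their product\<close>

abbreviation first_block :: "nat \<Rightarrow> 'a::{ring,monoid_mult} mat \<Rightarrow> 'a mat \<Rightarrow> 'a mat" where
  "first_block n A C \<equiv> four_block_mat A (- C) (0\<^sub>m n n) (0\<^sub>m n n)"

abbreviation middle_block :: "nat \<Rightarrow> 'a::{ring,monoid_mult} mat \<Rightarrow> 'a mat" where
  "middle_block n A \<equiv> four_block_mat A (0\<^sub>m n n) (0\<^sub>m n n) (1\<^sub>m n)"

abbreviation last_block :: "nat \<Rightarrow> 'a::{ring,monoid_mult} mat \<Rightarrow> 'a mat" where
  "last_block n A \<equiv> four_block_mat A (0\<^sub>m n n) (1\<^sub>m n) (0\<^sub>m n n)"

text \<open>Multiplying from the right,
  \<open>[[D, 0], [0, I]] * [[P, 0], [I, 0]] = [[D * P, 0], [I, 0]]\<close>: the product accumulates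
  in the upper left block, while the lower right identity of each middle factor passes the lower
  left \<open>I\<close> on unchanged.\<close>

lemma mat_prod_list_middle_last:
  fixes As :: "'a::{ring,monoid_mult} mat list"
  assumes "set As \<subseteq> carrier_mat n n" "A \<in> carrier_mat n n"
  shows "mat_prod_list (2 * n) (map (middle_block n) As @ [last_block n A]) =
    last_block n (mat_prod_list n (As @ [A]))"
  using assms
proof (induction As)
  case Nil
  have "last_block n A \<in> carrier_mat (2 * n) (2 * n)"
    using Nil by (simp add: mult_2)
  then show ?case using Nil by (simp add: right_mult_one_mat_ring)
next
  case (Cons D As)
  define P where "P = mat_prod_list n (As @ [A])"
  have D: "D \<in> carrier_mat n n" and P: "P \<in> carrier_mat n n"
    using Cons.prems unfolding P_def by (auto intro!: mat_prod_list_carrier)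
  have "middle_block n D * last_block n P = last_block n (D * P)"
    using D P
    by (subst mult_four_block_mat[where ?nr1.0=n and ?nr2.0=n and ?n1.0=n and ?n2.0=n and ?nc1.0=n and ?nc2.0=n])
      (auto simp: left_mult_one_mat_ring[of "1\<^sub>m n" n n])
  then show ?case using Cons by (simp add: P_def)
qed

text \<open>The lower left \<open>I\<close> carried along by the preceding lemma finally meets
  \<open>- C\<close> in the first factor, so the upper left block becomes
  \<open>A * P + (- C) * I\<close>.\<close>

lemma mat_prod_list_blocks:
  fixes As :: "'a::{ring,monoid_mult} mat list"
  assumes A: "A \<in> carrier_mat n n" and "set As \<subseteq> carrier_mat n n" "D \<in> carrier_mat n n"
    and C: "C \<in> carrier_mat n n"
  shows "mat_prod_list (2 * n) (first_block n A C # map (middle_block n) As @ [last_block n D]) =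
    four_block_mat (mat_prod_list n (A # As @ [D]) - C) (0\<^sub>m n n) (0\<^sub>m n n) (0\<^sub>m n n)"
proof -
  define P where "P = mat_prod_list n (As @ [D])"
  have P: "P \<in> carrier_mat n n"
    using assms unfolding P_def by (auto intro!: mat_prod_list_carrier)
  have "first_block n A C * last_block n P =
      four_block_mat (A * P - C) (0\<^sub>m n n) (0\<^sub>m n n) (0\<^sub>m n n)"
    using A C P
    by (subst mult_four_block_mat[where ?nr1.0=n and ?nr2.0=n and ?n1.0=n and ?n2.0=n and ?nc1.0=n and ?nc2.0=n])
      (auto simp: right_mult_one_mat_ring add_uminus_minus_mat)
  then show ?thesis using assms by (simp add: mat_prod_list_middle_last P_def)
qed

section \<open>Timed Hoare triples\<close>

text \<open>Asserting the existence of one run is enough, because \<open>run_deterministic\<close>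
  makes it the only one. The time \<open>c\<close> is only an upper bound, so
  \<open>triple_conseq\<close> can round it up.\<close>

definition triple ::
  "('a::{ring,monoid_mult} state \<Rightarrow> bool) \<Rightarrow> prog \<Rightarrow> nat \<Rightarrow> ('a state \<Rightarrow> bool) \<Rightarrow> bool" where
  "triple P p c Q \<longleftrightarrow> (\<forall>s. P s \<longrightarrow> (\<exists>t s'. run p s t s' \<and> t \<le> c \<and> Q s'))"

lemma triple_conseq:
  assumes "triple P p c Q" "\<And>s. P' s \<Longrightarrow> P s" "c \<le> c'" "\<And>s. Q s \<Longrightarrow> Q' s"
  shows "triple P' p c' Q'"
  using assms unfolding triple_def by (meson order_trans)

lemma triple_Seq:
  assumes "triple P p c Q" "triple Q q d R"
  shows "triple P (Seq p q) (c + d) R"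
  unfolding triple_def
proof (intro allI impI)
  fix s assume "P s"
  then obtain t s' where 1: "run p s t s'" "t \<le> c" "Q s'"
    using assms(1) unfolding triple_def by blast
  then obtain u s'' where 2: "run q s' u s''" "u \<le> d" "R s''"
    using assms(2) unfolding triple_def by blast
  show "\<exists>t s''. run (Seq p q) s t s'' \<and> t \<le> c + d \<and> R s''"
    using run_Seq[OF 1(1) 2(1)] 1 2 by (meson add_mono)
qed

section \<open>Straight-line code, unrolled repetition and counting loops\<close>

fun block :: "instr list \<Rightarrow> prog" where
  "block [] = Skip"
| "block (i # is) = Seq (Do i) (block is)"

lemma run_block: "run (block is) s (length is) (fold exec is s)"
proof (induction "is" arbitrary: s)
  case Nil
  then show ?case by (simp add: run_Skip)
next
  case (Cons i "is")
  show ?case using run_Seq[OF run_Do Cons.IH] by simp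
qed

lemma triple_block:
  assumes "\<And>s. P s \<Longrightarrow> Q (fold exec is s)" "length is \<le> c"
  shows "triple P (block is) c Q"
  unfolding triple_def using assms run_block by blast

text \<open>The repetition is unrolled in the program text and costs neither tests nor a counter
  register. This suits repetition counts that depend on the fixed \<open>k\<close> only, not on the
  dimension.\<close>

fun rep :: "nat \<Rightarrow> prog \<Rightarrow> prog" where
  "rep 0 p = Skip"
| "rep (Suc m) p = Seq (rep m p) p"

lemma triple_rep:
  assumes "\<And>i. i < m \<Longrightarrow> triple (I i) p c (I (Suc i))"
  shows "triple (I 0) (rep m p) (m * c) (I m)"
  using assms
proof (induction m)
  case 0
  show ?case unfolding triple_def by (auto intro: run_Skip)
next
  case (Suc m)
  have "triple (I 0) (rep m p) (m * c) (I m)" using Suc by simp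
  from triple_Seq[OF this Suc.prems[of m]] show ?case by (simp add: add.commute)
qed

lemma triple_for:
  assumes regs: "\<And>i s. I i s \<Longrightarrow> reg s x = i \<and> reg s y = n"
    and body: "\<And>i. i < n \<Longrightarrow> triple (I i) p c (I (Suc i))"
  shows "triple (I 0) (While (CLess x y) p) (n * (c + 1) + 1) (I n)"
proof -
  let ?w = "While (CLess x y) p"
  \<comment> \<open>Induction downwards from \<open>n\<close>: after \<open>i\<close> rounds,
    \<open>n - i\<close> remain, each paying \<open>c\<close> for the body and 1 for the test, and
    the failing test at the end adds 1.\<close>
  have "triple (I i) ?w ((n - i) * (c + 1) + 1) (I n)" if "i \<le> n" for i
    using that
  proof (induction rule: inc_induct)
    case base
    show ?case unfolding triple_def
    proof (intro allI impI)
      fix s assume s: "I n s"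
      then have "run ?w s 1 s" using regs by (intro run_While_False) auto
      then show "\<exists>t s'. run ?w s t s' \<and> t \<le> (n - n) * (c + 1) + 1 \<and> I n s'"
        using s by auto
    qed
  next
    case (step i)
    show ?case unfolding triple_def
    proof (intro allI impI)
      fix s assume s: "I i s"
      then obtain t s' where 1: "run p s t s'" "t \<le> c" "I (Suc i) s'"
        using body[OF step.hyps(2)] unfolding triple_def by blast
      then obtain u s'' where 2: "run ?w s' u s''" "u \<le> (n - Suc i) * (c + 1) + 1" "I n s''"
        using step.IH unfolding triple_def by blast
      have "run ?w s (1 + t + u) s''"
        using regs[OF s] step.hyps by (intro run_While_True[OF _ 1(1) 2(1)]) auto
      moreover have "n - i = Suc (n - Suc i)" using step.hyps by simp
      then have "1 + t + u \<le> (n - i) * (c + 1) + 1" using 1 2 by simp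
      ultimately show "\<exists>t s'. run ?w s t s' \<and> t \<le> (n - i) * (c + 1) + 1 \<and> I n s'"
        using 2 by blast
    qed
  qed
  from this[of 0] show ?thesis by simp
qed

section \<open>Layout of the memory\<close>

definition addr :: "nat \<Rightarrow> nat \<Rightarrow> nat \<Rightarrow> nat \<Rightarrow> nat" where
  "addr m l i j = l * (m * m) + i * m + j"

text \<open>An address is \<open>(l * m + i) * m + j\<close>, so two divisions by \<open>m\<close>
  with remainder recover \<open>j\<close>, then \<open>i\<close> and \<open>l\<close>.\<close>

lemma addr_inject:
  assumes "i < m" "j < m" "i' < m" "j' < m"
  shows "addr m l i j = addr m l' i' j' \<longleftrightarrow> l = l' \<and> i = i' \<and> j = j'"
proof
  have eq: "addr m l i j = (l * m + i) * m + j" for l i j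
    by (simp add: addr_def algebra_simps)
  have dm: "addr m l i j div m div m = l" "addr m l i j div m mod m = i" "addr m l i j mod m = j"
    if "i < m" "j < m" for l i j
    using that unfolding eq by simp_all
  assume "addr m l i j = addr m l' i' j'"
  then show "l = l' \<and> i = i' \<and> j = j'" using dm assms by metis
qed simp

text \<open>
  Invariant of the reduction program: register 4 is the source pointer, register 5 the target
  pointer and register 8 the start of the output. The input \<open>f\<close> below \<open>B\<close> is intact, and entry
  \<open>(i, j)\<close> of the output matrix \<open>l\<close> is \<open>M l i j\<close>.
\<close>

definition conf :: "nat \<Rightarrow> nat \<Rightarrow> nat \<Rightarrow> (nat \<Rightarrow> 'a) \<Rightarrow> nat \<Rightarrow> nat \<Rightarrow>
    (nat \<Rightarrow> nat \<Rightarrow> nat \<Rightarrow> 'a) \<Rightarrow> 'a state \<Rightarrow> bool" where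
  "conf k n B f S D M s \<longleftrightarrow>
     reg s 0 = n \<and> reg s 2 = 2 * n \<and> reg s 3 = 1 \<and> reg s 4 = S \<and> reg s 5 = D \<and> reg s 8 = B \<and>
     (\<forall>a<B. mem s a = f a) \<and>
     (\<forall>l<k. \<forall>i<2*n. \<forall>j<2*n. mem s (B + addr (2*n) l i j) = M l i j)"

lemma conf_cong:
  assumes "conf k n B f S D M s" "S = S'" "D = D'"
    "\<And>l i j. l < k \<Longrightarrow> i < 2*n \<Longrightarrow> j < 2*n \<Longrightarrow> M l i j = M' l i j"
  shows "conf k n B f S' D' M' s"
  using assms unfolding conf_def by auto

lemma conf_reg_update:
  assumes "conf k n B f S D M s" "mem s' = mem s"
    "reg s' 0 = reg s 0" "reg s' 2 = reg s 2" "reg s' 3 = reg s 3" "reg s' 8 = reg s 8"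
    "reg s' 4 = S'" "reg s' 5 = D'"
  shows "conf k n B f S' D' M s'"
  using assms unfolding conf_def by auto

text \<open>The written address is at least \<open>B\<close>, which keeps the input intact, and by
  \<open>addr_inject\<close> it belongs to exactly one output entry.\<close>

lemma conf_write:
  assumes "conf k n B f S (B + addr (2*n) l i j) M s"
    "l < k" "i < 2*n" "j < 2*n"
    "mem s' = (mem s)(B + addr (2*n) l i j := v)"
    "reg s' 0 = reg s 0" "reg s' 2 = reg s 2" "reg s' 3 = reg s 3" "reg s' 8 = reg s 8"
    "reg s' 4 = S'" "reg s' 5 = D'"
    "\<And>l' i' j'. l' < k \<Longrightarrow> i' < 2*n \<Longrightarrow> j' < 2*n \<Longrightarrow>
       M' l' i' j' = (if l' = l \<and> i' = i \<and> j' = j then v else M l' i' j')"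
  shows "conf k n B f S' D' M' s'"
  using assms unfolding conf_def by (auto simp: addr_inject)

section \<open>The reduction program\<close>

text \<open>Applied to a zero target, \<open>RAdd 5 5 4\<close> copies and \<open>RSub 5 5 4\<close>
  negates, hence the instruction as parameter. The source is contiguous; in the target a row has
  length \<open>2 * n\<close>, so after \<open>n\<close> entries the pointer skips \<open>n\<close>
  more to reach the same column of the next row.\<close>

definition copy_block :: "instr \<Rightarrow> prog" where
  "copy_block ins = Seq (block [IConst 6 0]) (While (CLess 6 0)
     (Seq (block [IConst 7 0])
     (Seq (While (CLess 7 0) (block [ins, IAdd 4 4 3, IAdd 5 5 3, IAdd 7 7 3]))
          (block [IAdd 5 5 0, IAdd 6 6 3]))))"

text \<open>Advancing by \<open>2 * n + 1\<close> moves one row down and one column to the right in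
  a matrix of width \<open>2 * n\<close>.\<close>

definition write_diag :: "instr \<Rightarrow> prog" where
  "write_diag ins = Seq (block [IConst 6 0]) (While (CLess 6 0)
     (block [ins, IAdd 5 5 2, IAdd 5 5 3, IAdd 6 6 3]))"

text \<open>The column offset \<open>c\<close> selects the upper left block (\<open>c = 0\<close>)
  or the upper right one (\<open>c = n\<close>). A row costs \<open>5 * n + 5\<close> including its
  test, so the total is quadratic.\<close>

lemma triple_copy_block:
  fixes f :: "nat \<Rightarrow> 'a::{ring,monoid_mult}"
  assumes ins: "\<And>s :: 'a state. exec ins s =
      s\<lparr>mem := (mem s)(reg s 5 := g (mem s (reg s 5)) (mem s (reg s 4)))\<rparr>"
    and l: "l < k" and c: "c \<le> n" and S: "S + n * n \<le> B"
  shows "triple (conf k n B f S (B + addr (2*n) l 0 c) M) (copy_block ins) (10 * (n * n + 1))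
    (conf k n B f (S + n * n) (B + addr (2*n) l n c)
      (\<lambda>l' i' j'. if l' = l \<and> i' < n \<and> c \<le> j' \<and> j' < c + n
         then g (M l' i' j') (f (S + i' * n + (j' - c))) else M l' i' j'))"
proof -
  \<comment> \<open>Contents after \<open>i\<close> complete rows and \<open>j\<close> entries of
    row \<open>i\<close>.\<close>
  define N where "N i j = (\<lambda>l' i' j'.
    if l' = l \<and> c \<le> j' \<and> (i' < i \<and> j' < c + n \<or> i' = i \<and> j' < c + j)
    then g (M l' i' j') (f (S + i' * n + (j' - c))) else M l' i' j')" for i j
  define J where "J i j s \<longleftrightarrow>
    conf k n B f (S + i * n + j) (B + addr (2*n) l i (c + j)) (N i j) s \<and> reg s 6 = i \<and> reg s 7 = j"
    for i j s
  define I where "I i s \<longleftrightarrow>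
    conf k n B f (S + i * n) (B + addr (2*n) l i c) (N i 0) s \<and> reg s 6 = i" for i s
  have inner: "triple (J i j) (block [ins, IAdd 4 4 3, IAdd 5 5 3, IAdd 7 7 3])
      4 (J i (Suc j))" if i: "i < n" and j: "j < n" for i j
  proof (rule triple_block)
    fix s :: "'a state" assume "J i j s"
    then have conf: "conf k n B f (S + i * n + j) (B + addr (2*n) l i (c + j)) (N i j) s"
      and r: "reg s 6 = i" "reg s 7 = j" by (auto simp: J_def)
    let ?s' = "fold exec [ins, IAdd 4 4 3, IAdd 5 5 3, IAdd 7 7 3] s"
    have rs: "reg s 3 = 1" "reg s 4 = S + i * n + j" "reg s 5 = B + addr (2*n) l i (c + j)"
      using conf by (auto simp: conf_def)
    \<comment> \<open>The source cell lies below \<open>B\<close>, so it still holds its input value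
      although output has already been written.\<close>
    have "i * n + j < Suc i * n" using j by simp
    also have "\<dots> \<le> n * n" using i by (intro mult_le_mono1) simp
    finally have "S + i * n + j < B" using S by simp
    then have src: "mem s (S + i * n + j) = f (S + i * n + j)" using conf by (simp add: conf_def)
    have dst: "mem s (B + addr (2*n) l i (c + j)) = N i j l i (c + j)"
      using conf i j c l by (simp add: conf_def)
    have "N i j l i (c + j) = M l i (c + j)" by (simp add: N_def)
    then have m: "mem ?s' = (mem s)(B + addr (2*n) l i (c + j) := g (M l i (c + j)) (f (S + i * n + j)))"
      using rs src dst by (simp add: ins)
    have "conf k n B f (S + i * n + Suc j) (B + addr (2*n) l i (c + Suc j)) (N i (Suc j)) ?s'"
      by (rule conf_write[OF conf l _ _ m])
        (use i j c in \<open>auto simp: ins rs addr_def N_def\<close>)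
    then show "J i (Suc j) ?s'" using r rs by (simp add: J_def ins)
  qed simp
  have row: "triple (J i 0) (While (CLess 7 0) (block [ins, IAdd 4 4 3, IAdd 5 5 3, IAdd 7 7 3]))
      (n * (4 + 1) + 1) (J i n)" if "i < n" for i
    by (rule triple_for[of "J i"]) (use inner that in \<open>auto simp: J_def conf_def\<close>)
  have pre: "triple (I i) (block [IConst 7 0]) 1 (J i 0)" for i
    by (rule triple_block) (auto simp: I_def J_def elim!: conf_reg_update simp: conf_def)
  have post: "triple (J i n) (block [IAdd 5 5 0, IAdd 6 6 3]) 2 (I (Suc i))"
    for i
  proof (rule triple_block)
    fix s :: "'a state" assume "J i n s"
    then have conf: "conf k n B f (S + i * n + n) (B + addr (2*n) l i (c + n)) (N i n) s"
      and r: "reg s 6 = i" by (auto simp: J_def)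
    let ?s' = "fold exec [IAdd 5 5 0, IAdd 6 6 3] s"
    have rs: "reg s 0 = n" "reg s 3 = 1" "reg s 4 = S + i * n + n"
      "reg s 5 = B + addr (2*n) l i (c + n)"
      using conf by (auto simp: conf_def)
    have "conf k n B f (S + i * n + n) (B + addr (2*n) l (Suc i) c) (N i n) ?s'"
      by (rule conf_reg_update[OF conf]) (auto simp: rs addr_def)
    \<comment> \<open>Finishing row \<open>i\<close> is the same as starting row
      \<open>Suc i\<close> with no entries: the condition
      \<open>c \<le> j' \<and> j' < c + 0\<close> is empty.\<close>
    then have "conf k n B f (S + Suc i * n) (B + addr (2*n) l (Suc i) c) (N (Suc i) 0) ?s'"
      by (rule conf_cong) (auto simp: N_def less_Suc_eq)
    then show "I (Suc i) ?s'" using r rs by (simp add: I_def)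
  qed simp
  have body: "triple (I i) (Seq (block [IConst 7 0])
     (Seq (While (CLess 7 0) (block [ins, IAdd 4 4 3, IAdd 5 5 3, IAdd 7 7 3]))
          (block [IAdd 5 5 0, IAdd 6 6 3]))) (5 * n + 4) (I (Suc i))" if "i < n" for i
    by (rule triple_conseq[OF triple_Seq[OF pre triple_Seq[OF row[OF that] post]]]) auto
  have start: "triple (conf k n B f S (B + addr (2*n) l 0 c) M) (block [IConst 6 0]) 1 (I 0)"
  proof (rule triple_block)
    fix s :: "'a state" assume conf: "conf k n B f S (B + addr (2*n) l 0 c) M s"
    have "conf k n B f S (B + addr (2*n) l 0 c) M (fold exec [IConst 6 0] s)"
      by (rule conf_reg_update[OF conf]) (use conf in \<open>auto simp: conf_def\<close>)
    then have "conf k n B f (S + 0 * n) (B + addr (2*n) l 0 c) (N 0 0) (fold exec [IConst 6 0] s)"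
      by (rule conf_cong) (auto simp: N_def)
    then show "I 0 (fold exec [IConst 6 0] s)" by (simp add: I_def)
  qed simp
  have loop: "triple (I 0) (While (CLess 6 0) (Seq (block [IConst 7 0])
     (Seq (While (CLess 7 0) (block [ins, IAdd 4 4 3, IAdd 5 5 3, IAdd 7 7 3]))
          (block [IAdd 5 5 0, IAdd 6 6 3])))) (n * (5 * n + 4 + 1) + 1) (I n)"
    by (rule triple_for[of I]) (use body in \<open>auto simp: I_def conf_def\<close>)
  \<comment> \<open>With the square named \<open>q\<close>, the bound is linear in \<open>n\<close>
    and \<open>q\<close> and follows from \<open>n \<le> q\<close>.\<close>
  obtain q where q: "n * n = q" "n \<le> q" using le_square by blast
  have "n * (5 * n + 4 + 1) = 5 * (n * n) + 5 * n" by (simp add: algebra_simps)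
  then have time: "1 + (n * (5 * n + 4 + 1) + 1) \<le> 10 * (n * n + 1)"
    unfolding q(1) using q(2) by simp
  show ?thesis unfolding copy_block_def
    by (rule triple_conseq[OF triple_Seq[OF start loop] _ time])
      (auto simp: I_def N_def elim!: conf_cong)
qed

text \<open>The offset \<open>c\<close> selects the lower left (\<open>c = 0\<close>) or lower right
  (\<open>c = n\<close>) block. The final pointer is in the fictitious row \<open>2 * n\<close>,
  that is, in row 0 of the next matrix.\<close>

lemma triple_write_diag:
  fixes f :: "nat \<Rightarrow> 'a::{ring,monoid_mult}"
  assumes ins: "\<And>s :: 'a state. exec ins s = s\<lparr>mem := (mem s)(reg s 5 := v)\<rparr>"
    and l: "l < k" and c: "c \<le> n"
  shows "triple (conf k n B f S (B + addr (2*n) l n c) M) (write_diag ins) (10 * (n * n + 1))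
    (conf k n B f S (B + addr (2*n) l (2 * n) (c + n))
      (\<lambda>l' i' j'. if l' = l \<and> n \<le> i' \<and> j' = c + (i' - n) then v else M l' i' j'))"
proof -
  define N where "N i = (\<lambda>l' i' j'.
    if l' = l \<and> n \<le> i' \<and> i' < n + i \<and> j' = c + (i' - n) then v else M l' i' j')" for i
  define I where "I i s \<longleftrightarrow>
    conf k n B f S (B + addr (2*n) l (n + i) (c + i)) (N i) s \<and> reg s 6 = i" for i s
  have body: "triple (I i) (block [ins, IAdd 5 5 2, IAdd 5 5 3, IAdd 6 6 3])
      4 (I (Suc i))" if i: "i < n" for i
  proof (rule triple_block)
    fix s :: "'a state" assume "I i s"
    then have conf: "conf k n B f S (B + addr (2*n) l (n + i) (c + i)) (N i) s"
      and r: "reg s 6 = i" by (auto simp: I_def)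
    let ?s' = "fold exec [ins, IAdd 5 5 2, IAdd 5 5 3, IAdd 6 6 3] s"
    have rs: "reg s 2 = 2 * n" "reg s 3 = 1" "reg s 4 = S"
      "reg s 5 = B + addr (2*n) l (n + i) (c + i)"
      using conf by (auto simp: conf_def)
    have m: "mem ?s' = (mem s)(B + addr (2*n) l (n + i) (c + i) := v)"
      using rs by (simp add: ins)
    have "conf k n B f S (B + addr (2*n) l (n + Suc i) (c + Suc i)) (N (Suc i)) ?s'"
      by (rule conf_write[OF conf l _ _ m])
        (use i c in \<open>auto simp: ins rs addr_def N_def\<close>)
    then show "I (Suc i) ?s'" using r rs by (simp add: I_def ins)
  qed simp
  have start: "triple (conf k n B f S (B + addr (2*n) l n c) M) (block [IConst 6 0]) 1 (I 0)"
  proof (rule triple_block)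
    fix s :: "'a state" assume conf: "conf k n B f S (B + addr (2*n) l n c) M s"
    have "conf k n B f S (B + addr (2*n) l n c) M (fold exec [IConst 6 0] s)"
      by (rule conf_reg_update[OF conf]) (use conf in \<open>auto simp: conf_def\<close>)
    then have "conf k n B f S (B + addr (2*n) l (n + 0) (c + 0)) (N 0) (fold exec [IConst 6 0] s)"
      by (rule conf_cong) (auto simp: N_def)
    then show "I 0 (fold exec [IConst 6 0] s)" by (simp add: I_def)
  qed simp
  have loop: "triple (I 0) (While (CLess 6 0) (block [ins, IAdd 5 5 2, IAdd 5 5 3, IAdd 6 6 3]))
      (n * (4 + 1) + 1) (I n)"
    by (rule triple_for[of I]) (use body in \<open>auto simp: I_def conf_def\<close>)
  obtain q where q: "n * n = q" "n \<le> q" using le_square by blast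
  then have time: "1 + (n * (4 + 1) + 1) \<le> 10 * (n * n + 1)"
    by simp
  show ?thesis unfolding write_diag_def
    by (rule triple_conseq[OF triple_Seq[OF start loop] _ time])
      (auto simp: I_def N_def mult_2 elim!: conf_cong)
qed

section \<open>Computing the start of the output\<close>

definition setup_output :: "nat \<Rightarrow> prog" where
  "setup_output k = Seq (block [IConst 3 1, IAdd 2 0 0]) (Seq (rep (Suc k) (block [IAdd 9 9 0]))
     (Seq (While (CLess 6 0) (block [IAdd 8 8 9, IAdd 6 6 3])) (block [ICopy 5 8])))"

text \<open>Without multiplication of registers, \<open>B\<close> arises in two stages:
  \<open>Suc k\<close> unrolled additions put \<open>Suc k * n\<close> into register 9, and a loop
  adds this \<open>n\<close> times to register 8. The output entries are zero since the memory
  vanishes from \<open>B\<close> on.\<close>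

lemma triple_setup_output:
  fixes f :: "nat \<Rightarrow> 'a::{ring,monoid_mult}"
  assumes B: "B = Suc k * (n * n)" and f: "\<And>a. B \<le> a \<Longrightarrow> f a = 0"
  shows "triple (\<lambda>s. reg s = (\<lambda>_. 0)(0 := n) \<and> mem s = f) (setup_output k)
    ((k + 10) * (n * n + 1)) (conf k n B f 0 B (\<lambda>_ _ _. 0))"
proof -
  define I where "I q r i s \<longleftrightarrow> reg s 0 = n \<and> reg s 2 = 2 * n \<and> reg s 3 = 1 \<and> reg s 4 = 0 \<and>
    reg s 6 = i \<and> reg s 8 = r \<and> reg s 9 = q * n \<and> mem s = f" for q r i and s :: "'a state"
  have 1: "triple (\<lambda>s. reg s = (\<lambda>_. 0)(0 := n) \<and> mem s = f) (block [IConst 3 1, IAdd 2 0 0]) 2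
      (I 0 0 0)"
    by (rule triple_block) (auto simp: I_def)
  have 2: "triple (I 0 0 0) (rep (Suc k) (block [IAdd 9 9 0])) (Suc k * 1) (I (Suc k) 0 0)"
    by (rule triple_rep[of _ "\<lambda>q. I q 0 0"], rule triple_block) (auto simp: I_def)
  have 3: "triple (I (Suc k) (0 * (Suc k * n)) 0) (While (CLess 6 0) (block [IAdd 8 8 9, IAdd 6 6 3]))
      (n * (2 + 1) + 1) (I (Suc k) (n * (Suc k * n)) n)"
    by (rule triple_for[of "\<lambda>i. I (Suc k) (i * (Suc k * n)) i"], force simp: I_def, rule triple_block)
      (auto simp: I_def algebra_simps)
  have nB: "n * (Suc k * n) = B" by (simp add: B algebra_simps)
  have 4: "triple (I (Suc k) B n) (block [ICopy 5 8]) 1 (conf k n B f 0 B (\<lambda>_ _ _. 0))"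
    by (rule triple_block) (auto simp: I_def conf_def f)
  obtain q where q: "n * n = q" "n \<le> q" using le_square by blast
  then have time: "2 + (Suc k * 1 + (n * (2 + 1) + 1 + 1)) \<le> (k + 10) * (n * n + 1)"
    by (simp add: algebra_simps trans_le_add2)
  show ?thesis unfolding setup_output_def
    by (rule triple_conseq[OF triple_Seq[OF 1 triple_Seq[OF 2 triple_Seq[OF 3[unfolded nB mult_0] 4]]] _ time])
qed

text \<open>
  In \<open>first_step\<close>, writing zeros on a diagonal that is already zero only serves to advance the
  target pointer past the lower half of the matrix without computing \<open>n * n\<close>.
\<close>

definition first_step :: prog where
  "first_step = Seq (copy_block (RAdd 5 5 4)) (Seq (write_diag (RZero 5)) (block [ISub 5 5 0]))"

definition middle_step :: prog where
  "middle_step = Seq (copy_block (RAdd 5 5 4)) (Seq (block [IAdd 5 5 0])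
     (Seq (write_diag (ROne 5)) (block [ISub 5 5 2])))"

text \<open>After the last factor has been copied, the source pointer stands at \<open>C\<close>.
  Only then is \<open>- C\<close> put into the first output matrix, so the input is read in one
  sequential pass.\<close>

definition last_step :: prog where
  "last_step = Seq (copy_block (RAdd 5 5 4)) (Seq (write_diag (ROne 5))
     (Seq (block [ICopy 5 8, IAdd 5 5 0]) (copy_block (RSub 5 5 4))))"

text \<open>For \<open>k = 1\<close> one matrix would have to be both first and last factor; instead
  \<open>C\<close> is subtracted in place from the copied matrix. The closing block announces the
  start and the dimension of the output in registers 1 and 0.\<close>

definition reduction :: "nat \<Rightarrow> prog" where
  "reduction k = Seq (setup_output k) (Seq
     (if k = 1 then Seq (copy_block (RAdd 5 5 4)) (Seq (block [ICopy 5 8]) (copy_block (RSub 5 5 4)))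
      else Seq first_step (Seq (rep (k - 2) middle_step) last_step))
     (block [ICopy 1 8, ICopy 0 2]))"

text \<open>Describes the stages before \<open>last_step\<close>: the block \<open>- C\<close> of
  matrix 0 is still missing.\<close>

definition partial_entry :: "nat \<Rightarrow> (nat \<Rightarrow> 'a::{ring,monoid_mult}) \<Rightarrow> nat \<Rightarrow> nat \<Rightarrow> nat \<Rightarrow> nat \<Rightarrow> 'a"
where
  "partial_entry n f m l i j =
     (if l < m then
        if i < n \<and> j < n then f (addr n l i j) else if 0 < l \<and> n \<le> i \<and> j = i then 1 else 0
      else 0)"

text \<open>Covers \<open>k = 1\<close> and \<open>k \<ge> 2\<close> together. Matrices are numbered
  from 0, so index \<open>k\<close> in the input is \<open>C\<close> and \<open>k - 1\<close> is the
  last factor.\<close>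

definition final_entry :: "nat \<Rightarrow> nat \<Rightarrow> (nat \<Rightarrow> 'a::{ring,monoid_mult}) \<Rightarrow> nat \<Rightarrow> nat \<Rightarrow> nat \<Rightarrow> 'a"
where
  "final_entry k n f l i j =
     (if i < n \<and> j < n then f (addr n l i j) - (if k = 1 then f (addr n k i j) else 0)
      else if l = 0 then if k \<noteq> 1 \<and> i < n then - f (addr n k i (j - n)) else 0
      else if l = k - 1 then if n \<le> i \<and> j = i - n then 1 else 0
      else if n \<le> i \<and> j = i then 1 else 0)"

section \<open>Effect and cost of the three kinds of steps\<close>

lemma triple_first_step:
  fixes f :: "nat \<Rightarrow> 'a::{ring,monoid_mult}"
  assumes "0 < k" and B: "B = Suc k * (n * n)"
  shows "triple (conf k n B f 0 B (\<lambda>_ _ _. 0)) first_step (30 * (n * n + 1))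
    (conf k n B f (1 * (n * n)) (B + addr (2*n) 1 0 0) (partial_entry n f 1))"
proof -
  have D: "B = B + addr (2*n) 0 0 0" by (simp add: addr_def)
  have "triple (conf k n B f 0 (B + addr (2*n) 0 0 0) (\<lambda>_ _ _. 0)) (copy_block (RAdd 5 5 4)) (10 * (n * n + 1))
    (conf k n B f (0 + n * n) (B + addr (2*n) 0 n 0)
      (\<lambda>l' i' j'. if l' = 0 \<and> i' < n \<and> 0 \<le> j' \<and> j' < 0 + n
         then 0 + f (0 + i' * n + (j' - 0)) else 0))"
    by (rule triple_copy_block[where g="(+)"]) (use assms in auto)
  note 1 = this[folded D]
  note 2 = triple_write_diag[where ins="RZero 5" and v=0, OF _ \<open>0 < k\<close> le0]
  \<comment> \<open>Row \<open>2 * n\<close> of matrix 0 is row 0 of matrix 1, so the pointer is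
    \<open>n\<close> cells past the start of matrix 1.\<close>
  have 3: "triple (conf k n B f S (B + addr (2*n) 0 (2*n) (0 + n)) M) (block [ISub 5 5 0]) 1
    (conf k n B f S (B + addr (2*n) 1 0 0) M)" for S M
    by (rule triple_block, rule conf_reg_update, assumption) (auto simp: conf_def addr_def)
  show ?thesis unfolding first_step_def
    by (rule triple_conseq[OF triple_Seq[OF 1 triple_Seq[OF 2 3]]])
      (auto elim!: conf_cong simp: partial_entry_def addr_def)
qed

lemma triple_middle_step:
  fixes f :: "nat \<Rightarrow> 'a::{ring,monoid_mult}"
  assumes l: "0 < l" "l < k" and B: "B = Suc k * (n * n)"
  shows "triple (conf k n B f (l * (n * n)) (B + addr (2*n) l 0 0) (partial_entry n f l))
    middle_step (30 * (n * n + 1))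
    (conf k n B f (Suc l * (n * n)) (B + addr (2*n) (Suc l) 0 0) (partial_entry n f (Suc l)))"
proof -
  have "Suc l * (n * n) \<le> B" unfolding B using l by (intro mult_le_mono1) simp
  then have "l * (n * n) + n * n \<le> B" by simp
  note 1 = triple_copy_block[where ins="RAdd 5 5 4" and g="(+)", OF _ \<open>l < k\<close> le0 this]
  have 2: "triple (conf k n B f S (B + addr (2*n) l n 0) M) (block [IAdd 5 5 0]) 1
    (conf k n B f S (B + addr (2*n) l n n) M)" for S M
    by (rule triple_block, rule conf_reg_update, assumption) (auto simp: conf_def addr_def)
  note 3 = triple_write_diag[where ins="ROne 5" and v=1, OF _ \<open>l < k\<close> le_refl]
  \<comment> \<open>The diagonal started in column \<open>n\<close>, so here the overshoot is
    \<open>2 * n\<close>.\<close>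
  have 4: "triple (conf k n B f S (B + addr (2*n) l (2*n) (n + n)) M) (block [ISub 5 5 2]) 1
    (conf k n B f S (B + addr (2*n) (Suc l) 0 0) M)" for S M
    by (rule triple_block, rule conf_reg_update, assumption) (auto simp: conf_def addr_def)
  show ?thesis unfolding middle_step_def
    by (rule triple_conseq[OF triple_Seq[OF 1 triple_Seq[OF 2 triple_Seq[OF 3 4]]]])
      (use l in \<open>auto elim!: conf_cong simp: partial_entry_def addr_def\<close>)
qed

lemma triple_last_step:
  fixes f :: "nat \<Rightarrow> 'a::{ring,monoid_mult}"
  assumes k: "k = Suc l" and l: "0 < l" and B: "B = Suc k * (n * n)"
  shows "triple (conf k n B f (l * (n * n)) (B + addr (2*n) l 0 0) (partial_entry n f l))
    last_step (40 * (n * n + 1))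
    (conf k n B f B (B + addr (2*n) 0 n n) (final_entry k n f))"
proof -
  have lk: "l < k" "0 < k" using k by auto
  \<comment> \<open>The last factor and \<open>C\<close> are the final two input blocks; the second
    ends exactly at \<open>B\<close>.\<close>
  have S: "l * (n * n) + n * n \<le> B" "l * (n * n) + n * n + n * n \<le> B" unfolding B k by auto
  note 1 = triple_copy_block[where ins="RAdd 5 5 4" and g="(+)", OF _ lk(1) le0 S(1)]
  note 2 = triple_write_diag[where ins="ROne 5" and v=1, OF _ lk(1) le0]
  have 3: "triple (conf k n B f S D M) (block [ICopy 5 8, IAdd 5 5 0]) 2
    (conf k n B f S (B + addr (2*n) 0 0 n) M)" for S D M
    by (rule triple_block, rule conf_reg_update, assumption) (auto simp: conf_def addr_def)
  note 4 = triple_copy_block[where ins="RSub 5 5 4" and g="(-)", OF _ lk(2) le_refl S(2)]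
  show ?thesis unfolding last_step_def
    by (rule triple_conseq[OF triple_Seq[OF 1 triple_Seq[OF 2 triple_Seq[OF 3 4]]]])
      (use k l B in \<open>auto elim!: conf_cong simp: partial_entry_def final_entry_def addr_def add.commute[of "n * n"]\<close>)
qed

lemma triple_reduction:
  fixes f :: "nat \<Rightarrow> 'a::{ring,monoid_mult}"
  assumes "0 < k" and B: "B = Suc k * (n * n)" and f: "\<And>a. B \<le> a \<Longrightarrow> f a = 0"
  shows "triple (\<lambda>s. reg s = (\<lambda>_. 0)(0 := n) \<and> mem s = f) (reduction k)
    ((31 * k + 100) * (n * n + 1))
    (\<lambda>s. reg s 0 = 2 * n \<and> (\<forall>l<k. \<forall>i<2*n. \<forall>j<2*n.
       mem s (reg s 1 + addr (2*n) l i j) = final_entry k n f l i j))"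
proof -
  define p where "p =
    (if k = 1 then Seq (copy_block (RAdd 5 5 4)) (Seq (block [ICopy 5 8]) (copy_block (RSub 5 5 4)))
     else Seq first_step (Seq (rep (k - 2) middle_step) last_step))"
  \<comment> \<open>The two cases leave the pointers at different places, and only the output
    matters afterwards.\<close>
  have "\<exists>S D. triple (conf k n B f 0 B (\<lambda>_ _ _. 0)) p ((30 * k + 80) * (n * n + 1))
    (conf k n B f S D (final_entry k n f))"
  proof (cases "k = 1")
    case True
    have S: "0 + n * n \<le> B" "0 + n * n + n * n \<le> B" unfolding B True by auto
    note 1 = triple_copy_block[where ins="RAdd 5 5 4" and g="(+)", OF _ \<open>0 < k\<close> le0 S(1)]
    have 2: "triple (conf k n B f S D M) (block [ICopy 5 8]) 1
      (conf k n B f S (B + addr (2*n) 0 0 0) M)" for S D M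
      by (rule triple_block, rule conf_reg_update, assumption) (auto simp: conf_def addr_def)
    note 3 = triple_copy_block[where ins="RSub 5 5 4" and g="(-)", OF _ \<open>0 < k\<close> le0 S(2)]
    have "triple (conf k n B f 0 B (\<lambda>_ _ _. 0)) p ((30 * k + 80) * (n * n + 1))
      (conf k n B f (0 + n * n + n * n) (B + addr (2*n) 0 n 0) (final_entry k n f))"
      unfolding p_def if_P[OF True]
      by (rule triple_conseq[OF triple_Seq[OF 1 triple_Seq[OF 2 3]]])
        (use True in \<open>auto elim!: conf_cong simp: final_entry_def addr_def\<close>)
    then show ?thesis by blast
  next
    case False
    then obtain m where k: "k = Suc (Suc m)" using \<open>0 < k\<close> by (cases k; cases "k - 1") auto
    \<comment> \<open>The index is shifted: \<open>I q\<close> holds once \<open>Suc q\<close>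
      matrices are in place, the first of them by \<open>first_step\<close>.\<close>
    define I where "I q = conf k n B f (Suc q * (n * n)) (B + addr (2*n) (Suc q) 0 0)
      (partial_entry n f (Suc q))" for q
    have first: "triple (conf k n B f 0 B (\<lambda>_ _ _. 0)) first_step (30 * (n * n + 1)) (I 0)"
      using triple_first_step[OF assms(1,2)] by (simp add: I_def)
    have "triple (I 0) (rep m middle_step) (m * (30 * (n * n + 1))) (I m)"
      by (rule triple_rep) (unfold I_def, rule triple_middle_step, use k B in auto)
    moreover have "triple (I m) last_step (40 * (n * n + 1))
        (conf k n B f B (B + addr (2*n) 0 n n) (final_entry k n f))"
      unfolding I_def by (rule triple_last_step) (use k B in auto)
    ultimately have "triple (conf k n B f 0 B (\<lambda>_ _ _. 0)) p
      (30 * (n * n + 1) + (m * (30 * (n * n + 1)) + 40 * (n * n + 1)))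
      (conf k n B f B (B + addr (2*n) 0 n n) (final_entry k n f))"
      unfolding p_def if_not_P[OF False] using k by (intro triple_Seq[OF first] triple_Seq) simp_all
    moreover have "30 * (n * n + 1) + (m * (30 * (n * n + 1)) + 40 * (n * n + 1))
        \<le> (30 * k + 80) * (n * n + 1)"
      unfolding k by (simp add: algebra_simps)
    ultimately have "triple (conf k n B f 0 B (\<lambda>_ _ _. 0)) p ((30 * k + 80) * (n * n + 1))
      (conf k n B f B (B + addr (2*n) 0 n n) (final_entry k n f))"
      unfolding triple_def using le_trans by meson
    then show ?thesis by blast
  qed
  then obtain S D where main: "triple (conf k n B f 0 B (\<lambda>_ _ _. 0)) p
    ((30 * k + 80) * (n * n + 1)) (conf k n B f S D (final_entry k n f))" by blast
  have finish: "triple (conf k n B f S D (final_entry k n f)) (block [ICopy 1 8, ICopy 0 2]) 2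
    (\<lambda>s. reg s 0 = 2 * n \<and> (\<forall>l<k. \<forall>i<2*n. \<forall>j<2*n.
       mem s (reg s 1 + addr (2*n) l i j) = final_entry k n f l i j))"
    by (rule triple_block) (auto simp: conf_def)
  have time: "(k + 10) * (n * n + 1) + ((30 * k + 80) * (n * n + 1) + 2)
      \<le> (31 * k + 100) * (n * n + 1)"
    by (simp add: algebra_simps)
  show ?thesis unfolding reduction_def p_def[symmetric]
    by (rule triple_conseq[OF triple_Seq[OF triple_setup_output[OF B f] triple_Seq[OF main finish]] _ time])
qed

section \<open>Correctness of the reduction\<close>

text \<open>Links memory to algebra: the numbers left by the program are the entries of the block
  matrices, whose product is governed by \<open>mat_prod_list_blocks\<close>.\<close>

lemma AllZeroes_instance_of_MMV:
  fixes As :: "'a::{ring,monoid_mult} mat list"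
  assumes "0 < k" and len: "length As = k" and As: "set As \<subseteq> carrier_mat n n"
    and C: "C \<in> carrier_mat n n"
    and f: "\<And>l i j. l \<le> k \<Longrightarrow> i < n \<Longrightarrow> j < n \<Longrightarrow> f (addr n l i j) = ((As @ [C]) ! l) $$ (i, j)"
  obtains Bs where "length Bs = k" "set Bs \<subseteq> carrier_mat (2 * n) (2 * n)"
    "\<And>l i j. l < k \<Longrightarrow> i < 2 * n \<Longrightarrow> j < 2 * n \<Longrightarrow> (Bs ! l) $$ (i, j) = final_entry k n f l i j"
    "mat_prod_list (2 * n) Bs = 0\<^sub>m (2 * n) (2 * n) \<longleftrightarrow> mat_prod_list n As = C"
proof (cases "k = 1")
  case True
  then obtain A where A: "As = [A]" using len by (metis length_0_conv length_Suc_conv One_nat_def)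
  then have cA: "A \<in> carrier_mat n n" using As by simp
  let ?F = "four_block_mat (A - C) (0\<^sub>m n n) (0\<^sub>m n n) (0\<^sub>m n n)"
  have cF: "?F \<in> carrier_mat (2 * n) (2 * n)" unfolding mult_2 using cA C
    by (intro four_block_carrier_mat) auto
  show ?thesis
  proof (rule that[of "[?F]"])
    fix l i j assume "l < k" "i < 2 * n" "j < 2 * n"
    then show "([?F] ! l) $$ (i, j) = final_entry k n f l i j"
      using True A cA C f[of 0 i j] f[of 1 i j] by (auto simp: final_entry_def)
  next
    show "mat_prod_list (2 * n) [?F] = 0\<^sub>m (2 * n) (2 * n) \<longleftrightarrow> mat_prod_list n As = C"
      using A cA C cF
      by (simp add: right_mult_one_mat_ring four_block_minus_eq_zero_iff)
  qed (use cF True in auto)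
next
  case False
  then obtain m where k: "k = Suc (Suc m)" using \<open>0 < k\<close> by (cases k; cases "k - 1") auto
  then obtain A As' where A: "As = A # As'" "length As' = Suc m"
    using len by (auto simp: length_Suc_conv)
  then obtain Ms D where As': "As' = Ms @ [D]" by (cases As' rule: rev_cases) auto
  then have Ms: "length Ms = m" using A by simp
  have carr: "A \<in> carrier_mat n n" "set Ms \<subseteq> carrier_mat n n" "D \<in> carrier_mat n n"
    using As A As' by auto
  let ?Bs = "first_block n A C # map (middle_block n) Ms @ [last_block n D]"
  show ?thesis
  proof (rule that[of ?Bs])
    show "set ?Bs \<subseteq> carrier_mat (2 * n) (2 * n)"
      using carr C by (auto simp: mult_2)
  next
    fix l i j assume l: "l < k" and ij: "i < 2 * n" "j < 2 * n"
    \<comment> \<open>First, middle and last factor have different block shapes.\<close>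
    consider "l = 0" | l' where "l = Suc l'" "l' < m" | "l = Suc m" "l = k - 1"
      using l k by (cases l) force+
    then show "(?Bs ! l) $$ (i, j) = final_entry k n f l i j"
    proof cases
      case 1
      then show ?thesis
        using ij carr C A As' Ms k f[of 0 i j] f[of k i "j - n"] by (auto simp: final_entry_def nth_append)
    next
      case 2
      have M: "Ms ! l' \<in> carrier_mat n n" using 2 Ms carr by auto
      then show ?thesis
        using 2 ij A As' Ms k f[of l i j] by (auto simp: final_entry_def nth_append)
    next
      case 3
      then show ?thesis
        using ij carr A As' Ms k f[of l i j] by (auto simp: final_entry_def nth_append)
    qed
  next
    have "mat_prod_list n As \<in> carrier_mat n n" using As by (rule mat_prod_list_carrier)
    then show "mat_prod_list (2 * n) ?Bs = 0\<^sub>m (2 * n) (2 * n) \<longleftrightarrow> mat_prod_list n As = C"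
      using mat_prod_list_blocks[OF carr C] A As' C
      by (simp add: four_block_minus_eq_zero_iff)
  qed (use k Ms in auto)
qed

section \<open>The reduction property and the quadratic time bound\<close>

lemma is_reduction_MMV_AllZeroes:
  assumes "0 < k"
  shows "is_reduction (reduction k) (MMV k :: 'a::{ring,monoid_mult} problem) (AllZeroes k)
    (\<lambda>n. 2 * n) (\<lambda>n. (31 * k + 100) * (n * n + 1))"
  unfolding is_reduction_def
proof (intro allI ballI)
  fix n and x :: "'a mat list" assume "x \<in> instances (MMV k) n"
  then obtain As C where x: "x = As @ [C]" and len: "length As = k"
    and As: "set As \<subseteq> carrier_mat n n" and C: "C \<in> carrier_mat n n"
    by (auto simp: MMV_def)
  define s0 where "s0 = initial_state n x"
  define f where "f = mem s0"
  have f: "f (addr n l i j) = ((As @ [C]) ! l) $$ (i, j)" if "l \<le> k" "i < n" "j < n" for l i j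
    using represents_initial_state[of n x] that len
    by (auto simp: f_def s0_def represents_def addr_def x initial_state_def)
  have f0: "f a = 0" if "Suc k * (n * n) \<le> a" for a
    using that len by (simp add: f_def s0_def initial_state_def x)
  have "reg s0 = (\<lambda>_. 0)(0 := n) \<and> mem s0 = f" by (simp add: f_def s0_def initial_state_def)
  then obtain t s where run: "run (reduction k) s0 t s" "t \<le> (31 * k + 100) * (n * n + 1)"
    and s: "reg s 0 = 2 * n" "\<And>l i j. l < k \<Longrightarrow> i < 2*n \<Longrightarrow> j < 2*n \<Longrightarrow>
       mem s (reg s 1 + addr (2*n) l i j) = final_entry k n f l i j"
    using triple_reduction[where n=n and f=f, OF assms refl f0] unfolding triple_def by blast
  obtain Bs where Bs: "length Bs = k" "set Bs \<subseteq> carrier_mat (2 * n) (2 * n)"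
    "\<And>l i j. l < k \<Longrightarrow> i < 2 * n \<Longrightarrow> j < 2 * n \<Longrightarrow> (Bs ! l) $$ (i, j) = final_entry k n f l i j"
    "mat_prod_list (2 * n) Bs = 0\<^sub>m (2 * n) (2 * n) \<longleftrightarrow> mat_prod_list n As = C"
    using AllZeroes_instance_of_MMV[OF assms len As C f] by blast
  have "represents s (2 * n) Bs"
    using s Bs unfolding represents_def addr_def by (simp add: add.assoc)
  moreover have "Bs \<in> instances (AllZeroes k) (2 * n)"
    using Bs by (simp add: AllZeroes_def)
  moreover have "x \<in> yes_instances (MMV k) n \<longleftrightarrow> Bs \<in> yes_instances (AllZeroes k) (2 * n)"
    using Bs len As C by (auto simp: MMV_def AllZeroes_def x)
  ultimately show "\<exists>t s. \<exists>y \<in> instances (AllZeroes k) (2 * n).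
      run (reduction k) (initial_state n x) t s \<and> t \<le> (31 * k + 100) * (n * n + 1) \<and>
      represents s (2 * n) y \<and>
      (x \<in> yes_instances (MMV k) n \<longleftrightarrow> y \<in> yes_instances (AllZeroes k) (2 * n))"
    using run unfolding s0_def by blast
qed

theorem theorem5p10:
  fixes k :: nat
  assumes "k > 0"
  shows "\<exists>p T. (\<lambda>n. real (T n)) \<in> O(\<lambda>n. real n ^ 2) \<and>
    is_reduction p (MMV k :: 'a::{ring,monoid_mult} problem) (AllZeroes k) (\<lambda>n. 2 * n) T"
proof (intro exI conjI)
  show "is_reduction (reduction k) (MMV k :: 'a problem) (AllZeroes k) (\<lambda>n. 2 * n)
      (\<lambda>n. (31 * k + 100) * (n * n + 1))"
    by (rule is_reduction_MMV_AllZeroes[OF assms])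
  \<comment> \<open>For \<open>n \<ge> 1\<close> the constant part is absorbed by
    \<open>n * n + 1 \<le> 2 * (n * n)\<close>; this fails at \<open>n = 0\<close>, so the estimate
    starts at 1.\<close>
  have "real ((31 * k + 100) * (n * n + 1)) \<le> 2 * real (31 * k + 100) * real n ^ 2" if "1 \<le> n" for n
  proof -
    have "1 \<le> n * n" using that by simp
    then have "(31 * k + 100) * (n * n + 1) \<le> (31 * k + 100) * (2 * (n * n))"
      by (intro mult_le_mono2) simp
    then have "real ((31 * k + 100) * (n * n + 1)) \<le> real ((31 * k + 100) * (2 * (n * n)))"
      by (rule of_nat_mono)
    then show ?thesis by (simp add: power2_eq_square algebra_simps)
  qed
  then show "(\<lambda>n. real ((31 * k + 100) * (n * n + 1))) \<in> O(\<lambda>n. real n ^ 2)"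
    by (intro bigoI[of _ "2 * real (31 * k + 100)"] eventually_sequentiallyI[of 1]) auto
qed

end
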